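(* Let $(\mathcal{S},g_{\mathcal{S}})$ and $(\mathcal{M},g_{\mathcal{M}})$ be Fisher-Rao manifolds with Fisher-Rao distances $\rho_{\mathcal{S}}$ and $\rho_{\mathcal{M}}$, and let $f:\mathcal{S}\to\mathcal{M}$ be an isometric embedding; write $\bar\theta=f(\theta)$. (i) If the isometric embedding is totally geodesic, then the Fisher-Rao distances coincide: for all $\theta_0,\theta_1\in\mathcal{S}$, $\rho_{\mathcal{S}}(\theta_0,\theta_1)=\rho_{\mathcal{M}}(\bar\theta_0,\bar\theta_1)$. (ii) If the isometric embedding is not totally geodesic, then the Fisher-Rao distance in $\mathcal{M}$ is a lower bound on the Fisher-Rao distance in $\mathcal{S}$: for all $\theta_0,\theta_1\in\mathcal{S}$, $\rho_{\mathcal{M}}(\bar\theta_0,\bar\theta_1)\leq\rho_{\mathcal{S}}(\theta_0,\theta_1)$.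
   Context: A Fisher-Rao manifold is a regular statistical model regarded as a Riemannian manifold with the Fisher information metric; its Fisher-Rao distance is the Riemannian distance (infimum of lengths of piecewise smooth curves). Fisher-Rao manifolds are assumed connected, smooth and such that any two points are joined by a length-minimizing geodesic. The embedding $f$ is isometric if the metric of $\mathcal{M}$ restricted to the embedded submanifold $\bar{\mathcal{S}}=f(\mathcal{S})$ coincides, via $f$, with the Fisher metric of $\mathcal{S}$. It is called totally geodesic here if the geodesics of $\mathcal{M}$ passing through any two points $\bar p_0,\bar p_1$ of $\bar{\mathcal{S}}$ (the geodesic arcs joining them) stay fully in $\bar{\mathcal{S}}$. *)

theory Defs
  imports "HOL-Probability.Probability"
begin

text \<open>
  A parametric model is given by a reference measure \<open>\<mu>\<close> on the sample space, a parameter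
  domain \<open>\<Theta>\<close> that is open in a finite-dimensional space, and densities
  \<open>p \<theta>\<close> with respect to \<open>\<mu>\<close>. Points of the statistical manifold are identified with their
  parameters, so \<open>\<Theta>\<close> is a global chart and every tangent space is the ambient vector space.
\<close>

section \<open>Smooth maps and curves\<close>

text \<open>Intended for open \<open>S\<close>, where it is the usual notion of a map of class \<open>C\<^sup>k\<close>.\<close>

primrec Ck_on :: "nat \<Rightarrow> ('a::euclidean_space \<Rightarrow> 'b::euclidean_space) \<Rightarrow> 'a set \<Rightarrow> bool" where
  "Ck_on 0 f S \<longleftrightarrow> continuous_on S f"
| "Ck_on (Suc k) f S \<longleftrightarrow> (\<forall>x\<in>S. f differentiable (at x)) \<and>
     (\<forall>v. Ck_on k (\<lambda>x. frechet_derivative f (at x) v) S)"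

definition smooth_on :: "('a::euclidean_space \<Rightarrow> 'b::euclidean_space) \<Rightarrow> 'a set \<Rightarrow> bool" where
  "smooth_on f S \<longleftrightarrow> (\<forall>k. Ck_on k f S)"

text \<open>Smoothness on a compact interval means having a smooth extension to an open neighbourhood.\<close>

definition smooth_on_interval :: "real \<Rightarrow> real \<Rightarrow> (real \<Rightarrow> 'a::euclidean_space) \<Rightarrow> bool" where
  "smooth_on_interval a b c \<longleftrightarrow>
     (\<exists>T h. open T \<and> {a..b} \<subseteq> T \<and> smooth_on h T \<and> (\<forall>t\<in>{a..b}. h t = c t))"

definition piecewise_smooth_path :: "(real \<Rightarrow> 'a::euclidean_space) \<Rightarrow> bool" where
  "piecewise_smooth_path c \<longleftrightarrow> path c \<and>
     (\<exists>(n::nat) (t::nat \<Rightarrow> real). t 0 = 0 \<and> t n = 1 \<and>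
        (\<forall>i<n. t i < t (Suc i) \<and> smooth_on_interval (t i) (t (Suc i)) c))"

definition velocity :: "(real \<Rightarrow> 'a::euclidean_space) \<Rightarrow> real \<Rightarrow> 'a" where
  "velocity c t = vector_derivative c (at t within {0..1})"

definition acceleration :: "(real \<Rightarrow> 'a::euclidean_space) \<Rightarrow> real \<Rightarrow> 'a" where
  "acceleration c t = vector_derivative (velocity c) (at t within {0..1})"

section \<open>Riemannian geometry in a global chart\<close>

type_synonym 'a metric_tensor = "'a \<Rightarrow> 'a \<Rightarrow> 'a \<Rightarrow> real"

text \<open>At breakpoints \<open>velocity\<close> may be unspecified; they form a null set.\<close>

definition curve_length :: "'a::euclidean_space metric_tensor \<Rightarrow> (real \<Rightarrow> 'a) \<Rightarrow> real" where
  "curve_length g c = integral {0..1} (\<lambda>t. sqrt (g (c t) (velocity c t) (velocity c t)))"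

definition curves_joining :: "'a::euclidean_space set \<Rightarrow> 'a \<Rightarrow> 'a \<Rightarrow> (real \<Rightarrow> 'a) set" where
  "curves_joining \<Theta> x y =
     {c. piecewise_smooth_path c \<and> path_image c \<subseteq> \<Theta> \<and> pathstart c = x \<and> pathfinish c = y}"

definition riemannian_distance ::
    "'a::euclidean_space set \<Rightarrow> 'a metric_tensor \<Rightarrow> 'a \<Rightarrow> 'a \<Rightarrow> real" where
  "riemannian_distance \<Theta> g x y = (INF c\<in>curves_joining \<Theta> x y. curve_length g c)"

text \<open>
  \<open>christoffel g \<theta> u v\<close> is the vector with components \<open>\<Gamma>\<^sup>k\<^sub>i\<^sub>j u\<^sup>i v\<^sup>j\<close>, i.e. the Levi-Civita
  derivative of the constant vector field \<open>v\<close> along \<open>u\<close>, given by the Koszul formula.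
\<close>

definition christoffel :: "'a::euclidean_space metric_tensor \<Rightarrow> 'a \<Rightarrow> 'a \<Rightarrow> 'a \<Rightarrow> 'a" where
  "christoffel g \<theta> u v = (THE z. \<forall>w. g \<theta> z w =
     (frechet_derivative (\<lambda>\<eta>. g \<eta> v w) (at \<theta>) u
      + frechet_derivative (\<lambda>\<eta>. g \<eta> u w) (at \<theta>) v
      - frechet_derivative (\<lambda>\<eta>. g \<eta> u v) (at \<theta>) w) / 2)"

definition geodesic ::
    "'a::euclidean_space set \<Rightarrow> 'a metric_tensor \<Rightarrow> (real \<Rightarrow> 'a) \<Rightarrow> bool" where
  "geodesic \<Theta> g c \<longleftrightarrow> smooth_on_interval 0 1 c \<and> path_image c \<subseteq> \<Theta> \<and>
     (\<forall>t\<in>{0..1}. acceleration c t + christoffel g (c t) (velocity c t) (velocity c t) = 0)"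

definition minimizing_geodesic ::
    "'a::euclidean_space set \<Rightarrow> 'a metric_tensor \<Rightarrow> 'a \<Rightarrow> 'a \<Rightarrow> (real \<Rightarrow> 'a) \<Rightarrow> bool" where
  "minimizing_geodesic \<Theta> g x y c \<longleftrightarrow> geodesic \<Theta> g c \<and> pathstart c = x \<and> pathfinish c = y \<and>
     curve_length g c = riemannian_distance \<Theta> g x y"

section \<open>Embeddings\<close>

definition smooth_embedding :: "'a::euclidean_space set \<Rightarrow> 'b::euclidean_space set \<Rightarrow>
    ('a \<Rightarrow> 'b) \<Rightarrow> bool" where
  "smooth_embedding S M f \<longleftrightarrow> smooth_on f S \<and> f ` S \<subseteq> M \<and>
     (\<forall>\<theta>\<in>S. inj (frechet_derivative f (at \<theta>))) \<and>
     (\<exists>f'. homeomorphism S (f ` S) f f')"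

definition isometric_embedding :: "'a::euclidean_space set \<Rightarrow> 'a metric_tensor \<Rightarrow>
    'b::euclidean_space set \<Rightarrow> 'b metric_tensor \<Rightarrow> ('a \<Rightarrow> 'b) \<Rightarrow> bool" where
  "isometric_embedding S gS M gM f \<longleftrightarrow> smooth_embedding S M f \<and>
     (\<forall>\<theta>\<in>S. \<forall>u v. gM (f \<theta>) (frechet_derivative f (at \<theta>) u) (frechet_derivative f (at \<theta>) v)
                  = gS \<theta> u v)"

definition totally_geodesic :: "'b::euclidean_space set \<Rightarrow> 'b metric_tensor \<Rightarrow> 'b set \<Rightarrow> bool" where
  "totally_geodesic M gM N \<longleftrightarrow>
     (\<forall>p0\<in>N. \<forall>p1\<in>N. \<forall>c. geodesic M gM c \<and> pathstart c = p0 \<and> pathfinish c = p1 \<longrightarrow>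
        path_image c \<subseteq> N)"

section \<open>Fisher-Rao manifolds\<close>

definition score :: "('a::euclidean_space \<Rightarrow> 'x \<Rightarrow> real) \<Rightarrow> 'a \<Rightarrow> 'a \<Rightarrow> 'x \<Rightarrow> real" where
  "score p \<theta> u x = frechet_derivative (\<lambda>\<eta>. ln (p \<eta> x)) (at \<theta>) u"

definition fisher_metric ::
    "'x measure \<Rightarrow> ('a::euclidean_space \<Rightarrow> 'x \<Rightarrow> real) \<Rightarrow> 'a metric_tensor" where
  "fisher_metric \<mu> p \<theta> u v = (\<integral>x. p \<theta> x * (score p \<theta> u x * score p \<theta> v x) \<partial>\<mu>)"

definition fisher_rao_distance :: "'x measure \<Rightarrow> ('a::euclidean_space \<Rightarrow> 'x \<Rightarrow> real) \<Rightarrow>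
    'a set \<Rightarrow> 'a \<Rightarrow> 'a \<Rightarrow> real" where
  "fisher_rao_distance \<mu> p \<Theta> = riemannian_distance \<Theta> (fisher_metric \<mu> p)"

text \<open>
  The support of \<open>p \<theta>\<close> does not depend on \<open>\<theta>\<close>; off the support the integrand of the Fisher
  metric vanishes because of the factor \<open>p \<theta> x\<close>.
\<close>

locale regular_statistical_model =
  fixes \<mu> :: "'x measure" and p :: "'a::euclidean_space \<Rightarrow> 'x \<Rightarrow> real" and \<Theta> :: "'a set"
  assumes open_domain: "open \<Theta>"
    and measurable_density: "\<theta> \<in> \<Theta> \<Longrightarrow> p \<theta> \<in> borel_measurable \<mu>"
    and nonneg_density: "\<theta> \<in> \<Theta> \<Longrightarrow> x \<in> space \<mu> \<Longrightarrow> 0 \<le> p \<theta> x"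
    and prob_density: "\<theta> \<in> \<Theta> \<Longrightarrow> prob_space (density \<mu> (p \<theta>))"
    and identifiable: "inj_on (\<lambda>\<theta>. density \<mu> (p \<theta>)) \<Theta>"
    and common_support:
      "\<theta> \<in> \<Theta> \<Longrightarrow> \<theta>' \<in> \<Theta> \<Longrightarrow> x \<in> space \<mu> \<Longrightarrow> p \<theta> x = 0 \<longleftrightarrow> p \<theta>' x = 0"
    and smooth_density: "x \<in> space \<mu> \<Longrightarrow> smooth_on (\<lambda>\<theta>. p \<theta> x) \<Theta>"
    and integrable_fisher:
      "\<theta> \<in> \<Theta> \<Longrightarrow> integrable \<mu> (\<lambda>x. p \<theta> x * (score p \<theta> u x * score p \<theta> v x))"
    and positive_definite_fisher: "\<theta> \<in> \<Theta> \<Longrightarrow> u \<noteq> 0 \<Longrightarrow> 0 < fisher_metric \<mu> p \<theta> u u"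

locale fisher_rao_manifold = regular_statistical_model +
  assumes smooth_metric: "smooth_on (\<lambda>\<theta>. fisher_metric \<mu> p \<theta> u v) \<Theta>"
    and connected_domain: "connected \<Theta>"
    and minimizing_geodesic_exists:
      "\<theta>\<^sub>0 \<in> \<Theta> \<Longrightarrow> \<theta>\<^sub>1 \<in> \<Theta> \<Longrightarrow> \<exists>c. minimizing_geodesic \<Theta> (fisher_metric \<mu> p) \<theta>\<^sub>0 \<theta>\<^sub>1 c"

end

theory Submission
  imports Defs
begin

text \<open>
  An isometric embedding preserves the length of curves, so the image of a minimizing geodesic of
  \<open>S\<close> competes in \<open>M\<close>; this gives the lower bound. If the embedding is totally geodesic, a
  minimizing geodesic of \<open>M\<close> between image points lies in the image and can be pulled back to a
  competitor in \<open>S\<close> of the same length. The pulled-back curve is smooth because an immersion has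
  smooth local left inverses, defined on open sets of the ambient space: after projecting to
  the tangent space this is the inverse function theorem in the class \<open>C\<^sup>k\<close>.
\<close>

section \<open>Calculus of maps of class C^k\<close>

lemma Ck_on_cong:
  assumes "open S" and "\<And>x. x \<in> S \<Longrightarrow> f x = g x"
  shows "Ck_on k f S \<longleftrightarrow> Ck_on k g S"
  using assms(2)
proof (induction k arbitrary: f g)
  case 0
  then show ?case by (simp cong: continuous_on_cong)
next
  case (Suc k)
  have der: "(f has_derivative D) (at x) \<longleftrightarrow> (g has_derivative D) (at x)" if "x \<in> S" for x D
    using has_derivative_transform_within_open[OF _ \<open>open S\<close> that] Suc.prems by metis
  then have diff: "f differentiable (at x) \<longleftrightarrow> g differentiable (at x)" if "x \<in> S" for x
    using that by (simp add: differentiable_def)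
  \<comment> \<open>\<open>frechet_derivative\<close> is a choice from the predicate
    \<open>has_derivative\<close>, so equal predicates give equal chosen derivatives on
    \<open>S\<close>.\<close>
  have "Ck_on k (\<lambda>x. frechet_derivative f (at x) v) S \<longleftrightarrow>
        Ck_on k (\<lambda>x. frechet_derivative g (at x) v) S" for v
    by (rule Suc.IH) (simp add: frechet_derivative_def der)
  with diff show ?case by simp
qed

lemma Ck_on_subset: "Ck_on k f T \<Longrightarrow> S \<subseteq> T \<Longrightarrow> Ck_on k f S"
  by (induction k arbitrary: f) (auto intro: continuous_on_subset)

lemma Ck_on_local:
  assumes "\<And>x. x \<in> S \<Longrightarrow> \<exists>U. open U \<and> x \<in> U \<and> Ck_on k f U"
  shows "Ck_on k f S"
  using assms
proof (induction k arbitrary: f)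
  case 0
  then have "isCont f x" if "x \<in> S" for x
    using that continuous_on_eq_continuous_at by (metis Ck_on.simps(1))
  then show ?case by (simp add: continuous_at_imp_continuous_on)
next
  case (Suc k)
  have "Ck_on k (\<lambda>x. frechet_derivative f (at x) v) S" for v
    by (rule Suc.IH) (use Suc.prems in fastforce)
  moreover have "f differentiable (at x)" if "x \<in> S" for x
    using Suc.prems[OF that] by auto
  ultimately show ?case by simp
qed

lemma Ck_on_SucD: "Ck_on (Suc k) f S \<Longrightarrow> Ck_on k f S"
proof (induction k arbitrary: f)
  case 0
  then show ?case
    by (auto intro!: continuous_at_imp_continuous_on differentiable_imp_continuous_within)
next
  case (Suc k)
  then show ?case by (metis Ck_on.simps(2))
qed

lemma Ck_on_imp_continuous_on: "Ck_on k f S \<Longrightarrow> continuous_on S f"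
  by (induction k) (use Ck_on_SucD in auto)

text \<open>The definition of \<open>Ck_on\<close> speaks of the chosen derivative; this rule
  accepts an explicit formula \<open>D\<close> for it, which is how the inductions below
  proceed.\<close>

lemma Ck_on_SucI:
  assumes "open S"
    and der: "\<And>x. x \<in> S \<Longrightarrow> (f has_derivative D x) (at x)"
    and "\<And>v. Ck_on k (\<lambda>x. D x v) S"
  shows "Ck_on (Suc k) f S"
proof -
  have "frechet_derivative f (at x) = D x" if "x \<in> S" for x
    using frechet_derivative_at[OF der[OF that]] by simp
  then have "Ck_on k (\<lambda>x. frechet_derivative f (at x) v) S" for v
    using Ck_on_cong[OF assms(1), of "\<lambda>x. frechet_derivative f (at x) v" "\<lambda>x. D x v"] assms(3)
    by simp
  then show ?thesis
    using der by (auto simp: differentiable_def)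
qed

lemma Ck_on_SucD_has_derivative:
  "Ck_on (Suc k) f S \<Longrightarrow> x \<in> S \<Longrightarrow> (f has_derivative frechet_derivative f (at x)) (at x)"
  by (simp add: frechet_derivative_works)

lemma Ck_on_const: "open S \<Longrightarrow> Ck_on k (\<lambda>x. c) S"
proof (induction k arbitrary: c)
  case (Suc k)
  show ?case by (rule Ck_on_SucI[OF Suc.prems]) (use Suc in \<open>auto intro: derivative_eq_intros\<close>)
qed auto

lemma Ck_on_ident: "open S \<Longrightarrow> Ck_on k (\<lambda>x. x) S"
  by (cases k) (auto intro: Ck_on_const)

lemma Ck_on_add:
  assumes "open S" "Ck_on k f S" "Ck_on k g S"
  shows "Ck_on k (\<lambda>x. f x + g x) S"
  using assms(2,3)
proof (induction k arbitrary: f g)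
  case (Suc k)
  show ?case
  proof (rule Ck_on_SucI[OF assms(1)])
    show "((\<lambda>x. f x + g x) has_derivative
        (\<lambda>v. frechet_derivative f (at x) v + frechet_derivative g (at x) v)) (at x)" if "x \<in> S" for x
      using Suc.prems that by (intro has_derivative_add) (auto simp flip: frechet_derivative_works)
  qed (use Suc in auto)
qed (auto intro: continuous_on_add)

lemma Ck_on_sum:
  assumes "open S" "\<And>i. i \<in> I \<Longrightarrow> Ck_on k (f i) S"
  shows "Ck_on k (\<lambda>x. \<Sum>i\<in>I. f i x) S"
  using assms(2)
  by (induction I rule: infinite_finite_induct) (auto intro: Ck_on_const Ck_on_add assms(1))

lemma Ck_on_bounded_linear:
  assumes "open S" "bounded_linear L" "Ck_on k f S"
  shows "Ck_on k (\<lambda>x. L (f x)) S"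
  using assms(3)
proof (induction k arbitrary: f)
  case (Suc k)
  show ?case
  proof (rule Ck_on_SucI[OF assms(1)])
    show "((\<lambda>x. L (f x)) has_derivative (\<lambda>v. L (frechet_derivative f (at x) v))) (at x)"
      if "x \<in> S" for x
      using Suc.prems that
      by (intro bounded_linear.has_derivative[OF assms(2)]) (auto simp flip: frechet_derivative_works)
  qed (use Suc in auto)
qed (use assms(2) in \<open>auto intro: bounded_linear.continuous_on\<close>)

lemma Ck_on_scaleR:
  assumes "open S" "Ck_on k s S" "Ck_on k g S"
  shows "Ck_on k (\<lambda>x. s x *\<^sub>R g x) S"
  using assms(2,3)
proof (induction k arbitrary: s g)
  case (Suc k)
  show ?case
  proof (rule Ck_on_SucI[OF assms(1)])
    show "((\<lambda>x. s x *\<^sub>R g x) has_derivative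
        (\<lambda>v. s x *\<^sub>R frechet_derivative g (at x) v + frechet_derivative s (at x) v *\<^sub>R g x)) (at x)"
      if "x \<in> S" for x
      using Suc.prems that by (intro has_derivative_scaleR) (auto simp flip: frechet_derivative_works)
    show "Ck_on k (\<lambda>x. s x *\<^sub>R frechet_derivative g (at x) v + frechet_derivative s (at x) v *\<^sub>R g x) S"
      for v
      \<comment> \<open>The product rule pairs a derivative of class C^k with an undifferentiated
        factor of class C^(k+1), whose order is lowered to meet the induction hypothesis.\<close>
      using Suc.prems Suc.prems[THEN Ck_on_SucD] by (intro Ck_on_add Suc.IH assms(1)) auto
  qed
qed (auto intro: continuous_on_scaleR)

lemma linear_sum_Basis:
  fixes L :: "'a::euclidean_space \<Rightarrow> 'b::real_vector"
  assumes "linear L"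
  shows "L v = (\<Sum>b\<in>Basis. (v \<bullet> b) *\<^sub>R L b)"
proof -
  have "L v = L (\<Sum>b\<in>Basis. (v \<bullet> b) *\<^sub>R b)" by (simp add: euclidean_representation)
  then show ?thesis
    using assms by (simp add: linear_sum linear_scale)
qed

text \<open>A family of linear maps does not take values in a Euclidean space type, so its
  regularity is stated for each fixed argument \<open>v\<close>. Expanding the moving argument
  \<open>z x\<close> in the basis leaves a finite sum of products of C^k maps.\<close>

lemma Ck_on_apply:
  fixes A :: "'c::euclidean_space \<Rightarrow> 'a::euclidean_space \<Rightarrow> 'b::euclidean_space"
  assumes "open S" and lin: "\<And>x. x \<in> S \<Longrightarrow> linear (A x)"
    and "\<And>v. Ck_on k (\<lambda>x. A x v) S" "Ck_on k z S"
  shows "Ck_on k (\<lambda>x. A x (z x)) S"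
proof -
  have "A x (z x) = (\<Sum>b\<in>Basis. (z x \<bullet> b) *\<^sub>R A x b)" if "x \<in> S" for x
    by (rule linear_sum_Basis[OF lin[OF that]])
  moreover have "Ck_on k (\<lambda>x. \<Sum>b\<in>Basis. (z x \<bullet> b) *\<^sub>R A x b) S"
    by (rule Ck_on_sum[OF assms(1)], rule Ck_on_scaleR[OF assms(1)],
        rule Ck_on_bounded_linear[OF assms(1) bounded_linear_inner_left]) (auto intro: assms)
  ultimately show ?thesis
    using Ck_on_cong[OF assms(1), of "\<lambda>x. A x (z x)"] by simp
qed

text \<open>Induction with \<open>f\<close> varying and \<open>h\<close> fixed: in the chain rule
  the induction hypothesis handles the derivative of \<open>f\<close> taken at \<open>h x\<close>,
  and \<open>Ck_on_apply\<close> pairs it with the derivative of \<open>h\<close>.\<close>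

lemma Ck_on_compose:
  assumes "open S" "open T" "h ` T \<subseteq> S" "Ck_on k f S" "Ck_on k h T"
  shows "Ck_on k (\<lambda>x. f (h x)) T"
  using assms(4,5)
proof (induction k arbitrary: f)
  case 0
  then show ?case using assms(3) by (auto intro: continuous_on_compose2)
next
  case (Suc k)
  show ?case
  proof (rule Ck_on_SucI[OF assms(2)])
    show "((\<lambda>x. f (h x)) has_derivative
        (\<lambda>v. frechet_derivative f (at (h x)) (frechet_derivative h (at x) v))) (at x)"
      if "x \<in> T" for x
    proof -
      have "(h has_derivative frechet_derivative h (at x)) (at x)"
        using Suc.prems that by (auto simp flip: frechet_derivative_works)
      moreover have "(f has_derivative frechet_derivative f (at (h x))) (at (h x))"
        using Suc.prems that assms(3) by (auto simp flip: frechet_derivative_works)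
      ultimately show ?thesis by (rule has_derivative_compose)
    qed
    show "Ck_on k (\<lambda>x. frechet_derivative f (at (h x)) (frechet_derivative h (at x) v)) T" for v
    proof (rule Ck_on_apply[where A = "\<lambda>x. frechet_derivative f (at (h x))", OF assms(2)])
      show "linear (frechet_derivative f (at (h x)))" if "x \<in> T" for x
        using Suc.prems that assms(3) by (auto intro!: linear_frechet_derivative)
      show "Ck_on k (\<lambda>x. frechet_derivative f (at (h x)) w) T" for w
        using Suc.prems(1) Ck_on_SucD[OF Suc.prems(2)] by (intro Suc.IH) auto
    qed (use Suc.prems in auto)
  qed
qed

section \<open>Regularity of the inverse of a family of linear maps\<close>

text \<open>
  No differentiability of \<open>A\<close> is needed because \<open>z\<close> vanishes at \<open>a\<close>. Applied to the inverse
  family \<open>B\<close>, which is only known to be continuous at that stage, in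
  \<open>B y w = B a w + B y (w - A y (B a w))\<close>, this differentiates \<open>B\<close>.
\<close>

lemma has_derivative_apply_vanishing:
  fixes A :: "'c::euclidean_space \<Rightarrow> 'a::euclidean_space \<Rightarrow> 'b::euclidean_space"
  assumes lin: "\<And>x. x \<in> S \<Longrightarrow> linear (A x)" and S: "open S" "a \<in> S"
    and cont: "\<And>v. isCont (\<lambda>x. A x v) a"
    and z: "(z has_derivative Z) (at a)" "z a = 0"
  shows "((\<lambda>x. A x (z x)) has_derivative (\<lambda>v. A a (Z v))) (at a)"
proof -
  \<comment> \<open>A product rule in which only the vanishing factor \<open>s\<close> is
    differentiable and \<open>g\<close> is merely continuous.\<close>
  have *: "((\<lambda>x. s x *\<^sub>R g x) has_derivative (\<lambda>v. s' v *\<^sub>R g a)) (at a)"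
    if s: "(s has_derivative s') (at a)" "s a = 0" and g: "isCont g a"
    for s :: "'c \<Rightarrow> real" and s' and g :: "'c \<Rightarrow> 'b"
  proof -
    have bl: "bounded_linear s'" using s(1) by (rule has_derivative_bounded_linear)
    obtain K where K: "K > 0" "\<And>v. \<bar>s' v\<bar> \<le> norm v * K"
      using bounded_linear.pos_bounded[OF bl] by auto
    have e: "((\<lambda>y. (s y - s' (y - a)) /\<^sub>R norm (y - a)) \<longlongrightarrow> 0) (at a)"
      using s unfolding has_derivative_at_within by simp
    have g0: "((\<lambda>y. g y - g a) \<longlongrightarrow> 0) (at a)"
      using g by (simp add: isCont_def LIM_zero)
    have bd: "((\<lambda>y. (s' (y - a) / norm (y - a)) *\<^sub>R (g y - g a)) \<longlongrightarrow> 0) (at a)"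
    proof (rule Lim_null_comparison[OF _ tendsto_mult_right_zero[OF tendsto_norm_zero[OF g0], of K]])
      show "\<forall>\<^sub>F y in at a. norm ((s' (y - a) / norm (y - a)) *\<^sub>R (g y - g a)) \<le> K * norm (g y - g a)"
      proof (rule always_eventually, rule allI)
        fix y
        have "\<bar>s' (y - a)\<bar> / norm (y - a) \<le> K"
          using K by (cases "y = a") (auto simp: field_simps)
        then show "norm ((s' (y - a) / norm (y - a)) *\<^sub>R (g y - g a)) \<le> K * norm (g y - g a)"
          unfolding norm_scaleR by (intro mult_right_mono) auto
      qed
    qed
    \<comment> \<open>The difference quotient splits into the remainder of \<open>s\<close> times
      \<open>g y\<close>, and a bounded quotient times \<open>g y - g a\<close>; both tend to
      0.\<close>
    have "((\<lambda>y. ((s y - s' (y - a)) /\<^sub>R norm (y - a)) *\<^sub>R g y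
         + (s' (y - a) / norm (y - a)) *\<^sub>R (g y - g a)) \<longlongrightarrow> 0 *\<^sub>R g a + 0) (at a)"
      by (intro tendsto_intros e bd isContD[OF g])
    moreover have "((s y - s' (y - a)) /\<^sub>R norm (y - a)) *\<^sub>R g y
        + (s' (y - a) / norm (y - a)) *\<^sub>R (g y - g a)
      = (s y *\<^sub>R g y - s a *\<^sub>R g a - s' (y - a) *\<^sub>R g a) /\<^sub>R norm (y - a)" for y
      by (simp add: s(2) algebra_simps divide_inverse)
    ultimately have "((\<lambda>y. (s y *\<^sub>R g y - s a *\<^sub>R g a - s' (y - a) *\<^sub>R g a) /\<^sub>R norm (y - a)) \<longlongrightarrow> 0) (at a)"
      by simp
    then show ?thesis
      by (simp add: has_derivative_at_within bounded_linear_compose[OF bounded_linear_scaleR_left bl])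
  qed
  have "((\<lambda>x. \<Sum>b\<in>Basis. (z x \<bullet> b) *\<^sub>R A x b) has_derivative
      (\<lambda>v. \<Sum>b\<in>Basis. (Z v \<bullet> b) *\<^sub>R A a b)) (at a)"
    by (intro has_derivative_sum * cont) (auto intro!: derivative_eq_intros z simp: z(2))
  then have "((\<lambda>x. A x (z x)) has_derivative (\<lambda>v. \<Sum>b\<in>Basis. (Z v \<bullet> b) *\<^sub>R A a b)) (at a)"
    by (rule has_derivative_transform_within_open[OF _ S]) (metis linear_sum_Basis lin)
  then show ?thesis
    by (simp add: linear_sum_Basis[OF lin[OF S(2)], symmetric])
qed

text \<open>The derivative of \<open>B\<close> is -B A' B, built from \<open>B\<close> itself and
  the first derivative of \<open>A\<close>, so class C^k of \<open>B\<close> improves to C^(k+1)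
  when \<open>A\<close> has that class. The base case rests on a lower bound for \<open>A a\<close>
  that persists at nearby points.\<close>

lemma Ck_on_inverse_family:
  fixes A B :: "'c::euclidean_space \<Rightarrow> 'a::euclidean_space \<Rightarrow> 'a"
  assumes "open S"
    and linA: "\<And>x. x \<in> S \<Longrightarrow> linear (A x)" and linB: "\<And>x. x \<in> S \<Longrightarrow> linear (B x)"
    and AB: "\<And>x w. x \<in> S \<Longrightarrow> A x (B x w) = w" and BA: "\<And>x v. x \<in> S \<Longrightarrow> B x (A x v) = v"
    and "\<And>v. Ck_on k (\<lambda>x. A x v) S"
  shows "Ck_on k (\<lambda>x. B x w) S"
  using assms(6)
proof (induction k arbitrary: w)
  case 0
  have "isCont (\<lambda>x. B x w) a" if a: "a \<in> S" for a
  proof -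
    have contA: "isCont (\<lambda>x. A x v) a" for v
      using 0[of v] assms(1) a by (simp add: continuous_on_eq_continuous_at)
    have inj: "inj (A a)" by (rule inj_on_inverseI) (rule BA[OF a])
    obtain c where c: "c > 0" "\<And>x. c * norm x \<le> norm (A a x)"
      using linear_inj_bounded_below_pos[OF linA[OF a] inj] by blast
    \<comment> \<open>\<open>e y\<close> dominates the operator norm of \<open>A y - A a\<close>;
      once it is below \<open>c / 2\<close>, half of the lower bound \<open>c\<close> survives for
      \<open>A y\<close>.\<close>
    define e where "e = (\<lambda>y. \<Sum>b\<in>Basis. norm (A y b - A a b))"
    define u where "u = B a w"
    have "(e \<longlongrightarrow> (\<Sum>b\<in>(Basis::'a set). norm (A a b - A a b))) (at a)"
      unfolding e_def by (intro tendsto_intros isContD[OF contA])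
    then have "(e \<longlongrightarrow> 0) (at a)" by simp
    then have "\<forall>\<^sub>F y in at a. e y < c / 2"
      using c(1) by (intro order_tendstoD) auto
    moreover have "\<forall>\<^sub>F y in at a. y \<in> S"
      using assms(1) a eventually_at_topological by blast
    ultimately have ev: "\<forall>\<^sub>F y in at a. norm (B y w - B a w) \<le> 2 / c * norm (A a u - A y u)"
    proof eventually_elim
      case (elim y)
      define x where "x = B y w - B a w"
      have "A y x - A a x = (\<Sum>b\<in>Basis. (x \<bullet> b) *\<^sub>R (A y b - A a b))"
        unfolding linear_sum_Basis[OF linA[OF elim(2)], of x] linear_sum_Basis[OF linA[OF a], of x]
        by (simp add: sum_subtractf scaleR_diff_right)
      also have "norm \<dots> \<le> (\<Sum>b\<in>Basis. norm x * norm (A y b - A a b))"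
        by (rule sum_norm_le) (auto intro!: mult_right_mono Basis_le_norm)
      also have "\<dots> \<le> norm x * (c / 2)"
        unfolding sum_distrib_left[symmetric]
        by (intro mult_left_mono less_imp_le[OF elim(1)[unfolded e_def]] norm_ge_zero)
      finally have "c / 2 * norm x \<le> norm (A y x)"
        using c(2)[of x] norm_triangle_ineq4[of "A y x" "A y x - A a x"] by (simp add: algebra_simps)
      \<comment> \<open>Both \<open>A y (B y w)\<close> and \<open>A a u\<close> equal
        \<open>w\<close>.\<close>
      also have "A y x = A a u - A y u"
        unfolding x_def linear_diff[OF linA[OF elim(2)]] by (simp add: u_def AB a elim(2))
      finally show ?case unfolding x_def[symmetric] using c(1) by (simp add: field_simps)
    qed
    have "((\<lambda>y. A a u - A y u) \<longlongrightarrow> A a u - A a u) (at a)"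
      by (intro tendsto_intros isContD[OF contA])
    then have "((\<lambda>y. 2 / c * norm (A a u - A y u)) \<longlongrightarrow> 0) (at a)"
      by (intro tendsto_mult_right_zero tendsto_norm_zero) simp
    then have "((\<lambda>y. B y w - B a w) \<longlongrightarrow> 0) (at a)"
      by (rule Lim_null_comparison[OF ev])
    then show ?thesis by (simp add: isCont_def LIM_zero_iff)
  qed
  then show ?case by (simp add: continuous_at_imp_continuous_on)
next
  case (Suc k)
  have IH: "Ck_on k (\<lambda>x. B x w) S" for w
    by (rule Suc.IH) (rule Ck_on_SucD[OF Suc.prems])
  define DA where "DA = (\<lambda>b x. frechet_derivative (\<lambda>x. A x b) (at x))"
  \<comment> \<open>\<open>Z x\<close> is the derivative at \<open>y = x\<close> of
    \<open>w - A y (B x w)\<close>, with the vector \<open>B x w\<close> frozen.\<close>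
  define Z where "Z = (\<lambda>x v. - (\<Sum>b\<in>Basis. (B x w \<bullet> b) *\<^sub>R DA b x v))"
  show ?case
  proof (rule Ck_on_SucI[OF assms(1)])
    fix a assume a: "a \<in> S"
    have "((\<lambda>y. w - (\<Sum>b\<in>Basis. (B a w \<bullet> b) *\<^sub>R A y b)) has_derivative Z a) (at a)"
      unfolding Z_def DA_def using Suc.prems a
      by (auto intro!: derivative_eq_intros simp flip: frechet_derivative_works)
    then have z: "((\<lambda>y. w - A y (B a w)) has_derivative Z a) (at a)"
      by (rule has_derivative_transform_within_open[OF _ assms(1) a])
        (simp flip: linear_sum_Basis[OF linA])
    have "((\<lambda>y. B y (w - A y (B a w))) has_derivative (\<lambda>v. B a (Z a v))) (at a)"
      using Ck_on_imp_continuous_on[OF IH] a assms(1)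
      by (intro has_derivative_apply_vanishing[OF linB assms(1) a _ z])
        (auto simp: AB a continuous_on_eq_continuous_at)
    from has_derivative_add[OF has_derivative_const this]
    have "((\<lambda>y. B a w + B y (w - A y (B a w))) has_derivative (\<lambda>v. B a (Z a v))) (at a)"
      by simp
    then show "((\<lambda>y. B y w) has_derivative (\<lambda>v. B a (Z a v))) (at a)"
      by (rule has_derivative_transform_within_open[OF _ assms(1) a])
        (simp add: linear_diff[OF linB] BA)
  next
    fix v
    have "Ck_on k (\<lambda>x. Z x v) S"
      unfolding Z_def DA_def using Suc.prems
      by (intro Ck_on_bounded_linear[OF assms(1) bounded_linear_minus[OF bounded_linear_ident]]
          Ck_on_sum Ck_on_scaleR assms(1)
          Ck_on_bounded_linear[OF assms(1) bounded_linear_inner_left] IH) auto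
    from Ck_on_apply[OF assms(1) linB IH this]
    show "Ck_on k (\<lambda>x. B x (Z x v)) S" .
  qed
qed

section \<open>Smooth local inverses and left inverses of immersions\<close>

lemma smooth_onD: "smooth_on f S \<Longrightarrow> x \<in> S \<Longrightarrow> (f has_derivative frechet_derivative f (at x)) (at x)"
  unfolding smooth_on_def by (rule Ck_on_SucD_has_derivative) auto

lemma smooth_on_derivative: "smooth_on f S \<Longrightarrow> Ck_on k (\<lambda>x. frechet_derivative f (at x) v) S"
  unfolding smooth_on_def by (metis Ck_on.simps(2))

text \<open>The inverse function theorem gives a differentiable \<open>g\<close> whose derivative at
  \<open>y\<close> inverts that of \<open>F\<close> at \<open>g y\<close>. If \<open>g\<close> is
  C^k, so is this inverse family by \<open>Ck_on_inverse_family\<close>, and hence \<open>g\<close>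
  is C^(k+1).\<close>

lemma smooth_on_local_inverse:
  fixes F :: "'a::euclidean_space \<Rightarrow> 'a"
  assumes "open S" "smooth_on F S" "x0 \<in> S" "inj (frechet_derivative F (at x0))"
  obtains U V g where "open U" "U \<subseteq> S" "x0 \<in> U" "open V" "homeomorphism U V F g" "smooth_on g V"
proof -
  \<comment> \<open>The inverse function theorem takes the derivative as a continuous map into the
    space of bounded linear operators; continuity there is checked on each vector.\<close>
  define F' where "F' = (\<lambda>x. Blinfun (frechet_derivative F (at x)))"
  have F'[simp]: "blinfun_apply (F' x) = frechet_derivative F (at x)" if "x \<in> S" for x
    unfolding F'_def
    by (rule bounded_linear_Blinfun_apply[OF has_derivative_bounded_linear[OF smooth_onD[OF assms(2) that]]])
  have lin: "linear (frechet_derivative F (at x))" if "x \<in> S" for x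
    by (rule has_derivative_linear[OF smooth_onD[OF assms(2) that]])
  obtain L where L: "linear L" "L \<circ> frechet_derivative F (at x0) = id"
    using linear_injective_left_inverse[OF lin[OF assms(3)] assms(4)] by blast
  have BL: "blinfun_apply (Blinfun L) = L"
    using L(1) by (simp add: bounded_linear_Blinfun_apply linear_conv_bounded_linear)
  have cont: "continuous_on S F'"
    by (rule continuous_on_blinfun_componentwise)
      (use Ck_on_imp_continuous_on[OF smooth_on_derivative[OF assms(2)]] in
        \<open>simp cong: continuous_on_cong\<close>)
  have "Blinfun L o\<^sub>L F' x0 = id_blinfun"
    using L(2) assms(3) by (intro blinfun_eqI) (simp add: BL fun_eq_iff)
  then obtain U V g g' where U: "open U" "U \<subseteq> S" "x0 \<in> U" and V: "open V" "homeomorphism U V F g"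
    and g': "\<And>y. y \<in> V \<Longrightarrow> (g has_derivative (g' y)) (at y)"
    "\<And>y. y \<in> V \<Longrightarrow> g' y = inv (blinfun_apply (F' (g y)))"
    "\<And>y. y \<in> V \<Longrightarrow> bij (blinfun_apply (F' (g y)))"
    using inverse_function_theorem[OF assms(1) _ cont assms(3)] smooth_onD[OF assms(2)] F'
    by (metis (lifting))
  have gV: "g ` V \<subseteq> S" using V(2) U(2) by (auto simp: homeomorphism_def)
  have "Ck_on k g V" for k
  proof (induction k)
    case 0
    then show ?case using V(2) by (simp add: homeomorphism_def)
  next
    case (Suc k)
    have "Ck_on k (\<lambda>y. g' y w) V" for w
    proof (rule Ck_on_inverse_family[where A = "\<lambda>y. frechet_derivative F (at (g y))", OF V(1)])
      fix y assume y: "y \<in> V"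
      then have gy: "g y \<in> S" using gV by auto
      show "linear (frechet_derivative F (at (g y)))" by (rule lin[OF gy])
      show "linear (g' y)" by (rule has_derivative_linear[OF g'(1)[OF y]])
      have b: "bij (frechet_derivative F (at (g y)))" using g'(3)[OF y] gy by simp
      show "frechet_derivative F (at (g y)) (g' y v) = v"
        "g' y (frechet_derivative F (at (g y)) v) = v" for v
        using g'(2)[OF y] gy b by (simp_all add: bij_is_surj surj_f_inv_f bij_is_inj)
    next
      show "Ck_on k (\<lambda>y. frechet_derivative F (at (g y)) v) V" for v
        by (rule Ck_on_compose[OF assms(1) V(1) gV smooth_on_derivative[OF assms(2)] Suc])
    qed
    from Ck_on_SucI[OF V(1) g'(1) this] show ?case .
  qed
  then show thesis using that U V by (simp add: smooth_on_def)
qed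

lemma smooth_on_compose:
  "open S \<Longrightarrow> open T \<Longrightarrow> h ` T \<subseteq> S \<Longrightarrow> smooth_on f S \<Longrightarrow> smooth_on h T \<Longrightarrow> smooth_on (\<lambda>x. f (h x)) T"
  by (simp add: smooth_on_def Ck_on_compose)

text \<open>If \<open>L\<close> is a linear left inverse of the derivative at \<open>x0\<close>,
  then \<open>L (f x)\<close> has the identity as derivative there and so admits a smooth local
  inverse \<open>g\<close> on \<open>V\<close>. The map \<open>g (L y)\<close> is then defined on
  the preimage of \<open>V\<close> under \<open>L\<close>, which is open in the ambient
  space.\<close>

lemma immersion_local_left_inverse:
  fixes f :: "'a::euclidean_space \<Rightarrow> 'b::euclidean_space"
  assumes "open S" "smooth_on f S" "x0 \<in> S" "inj (frechet_derivative f (at x0))"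
  obtains U W \<psi> where "open U" "U \<subseteq> S" "x0 \<in> U" "open W" "f ` U \<subseteq> W" "smooth_on \<psi> W"
    "\<And>x. x \<in> U \<Longrightarrow> \<psi> (f x) = x"
proof -
  obtain L where L: "linear L" "L \<circ> frechet_derivative f (at x0) = id"
    using linear_injective_left_inverse[OF has_derivative_linear[OF smooth_onD[OF assms(2,3)]] assms(4)]
    by blast
  then have bl: "bounded_linear L" by (simp add: linear_conv_bounded_linear)
  have "((\<lambda>x. L (f x)) has_derivative (\<lambda>v. L (frechet_derivative f (at x0) v))) (at x0)"
    by (rule bounded_linear.has_derivative[OF bl smooth_onD[OF assms(2,3)]])
  then have "frechet_derivative (\<lambda>x. L (f x)) (at x0) = (\<lambda>v. v)"
    using L(2) by (simp add: frechet_derivative_at[symmetric] fun_eq_iff)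
  then have inj: "inj (frechet_derivative (\<lambda>x. L (f x)) (at x0))" by simp
  have "smooth_on (\<lambda>x. L (f x)) S"
    using assms(1,2) by (simp add: smooth_on_def Ck_on_bounded_linear[OF _ bl])
  from smooth_on_local_inverse[OF assms(1) this assms(3) inj]
  obtain U V g where U: "open U" "U \<subseteq> S" "x0 \<in> U" and V: "open V"
    and hom: "homeomorphism U V (\<lambda>x. L (f x)) g" and g: "smooth_on g V" .
  have W: "open (L -` V)"
    using V bl by (simp add: open_vimage linear_continuous_on)
  have LW: "smooth_on L (L -` V)"
    unfolding smooth_on_def using Ck_on_bounded_linear[OF W bl Ck_on_ident[OF W]] by blast
  show thesis
  proof
    show "smooth_on (\<lambda>y. g (L y)) (L -` V)"
      by (rule smooth_on_compose[OF V W _ g LW]) auto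
    show "f ` U \<subseteq> L -` V"
      using hom by (auto simp: homeomorphism_def)
    show "g (L (f x)) = x" if "x \<in> U" for x
      using hom that by (auto simp: homeomorphism_def)
  qed (fact U(1) U(2) U(3) W)+
qed

section \<open>Smooth curves on compact intervals\<close>

lemma smooth_on_imp_continuous_on: "smooth_on f S \<Longrightarrow> continuous_on S f"
  unfolding smooth_on_def by (metis Ck_on_imp_continuous_on)

lemma smooth_on_subset: "smooth_on f T \<Longrightarrow> S \<subseteq> T \<Longrightarrow> smooth_on f S"
  unfolding smooth_on_def by (blast intro: Ck_on_subset)

lemma smooth_on_local:
  assumes "\<And>x. x \<in> S \<Longrightarrow> \<exists>U g. open U \<and> x \<in> U \<and> smooth_on g U \<and> (\<forall>y\<in>U. f y = g y)"
  shows "smooth_on f S"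
  unfolding smooth_on_def by (intro allI Ck_on_local) (metis assms Ck_on_cong smooth_on_def)

lemma smooth_on_interval_compose:
  assumes "smooth_on_interval a b d" "\<And>t. t \<in> {a..b} \<Longrightarrow> d t \<in> S" "open S" "smooth_on f S"
    and "\<And>t. t \<in> {a..b} \<Longrightarrow> c t = f (d t)"
  shows "smooth_on_interval a b c"
proof -
  obtain T h where h: "open T" "{a..b} \<subseteq> T" "smooth_on h T" "\<And>t. t \<in> {a..b} \<Longrightarrow> h t = d t"
    using assms(1) unfolding smooth_on_interval_def by blast
  define T' where "T' = T \<inter> h -` S"
  \<comment> \<open>Outside the interval the extension \<open>h\<close> may leave \<open>S\<close>,
    so its domain is shrunk to \<open>T'\<close>.\<close>
  have T': "open T'"
    unfolding T'_def
    by (rule continuous_open_preimage[OF smooth_on_imp_continuous_on[OF h(3)] h(1) assms(3)])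
  have "smooth_on (\<lambda>t. f (h t)) T'"
    by (rule smooth_on_compose[OF assms(3) T' _ assms(4) smooth_on_subset[OF h(3)]])
      (auto simp: T'_def)
  then show ?thesis
    unfolding smooth_on_interval_def using T' h assms(2,5)
    by (intro exI[of _ T'] exI[of _ "\<lambda>t. f (h t)"]) (auto simp: T'_def)
qed

lemma smooth_on_interval_imp_continuous_on:
  assumes "smooth_on_interval a b c"
  shows "continuous_on {a..b} c"
proof -
  obtain T h where h: "open T" "{a..b} \<subseteq> T" "smooth_on h T" "\<And>t. t \<in> {a..b} \<Longrightarrow> h t = c t"
    using assms unfolding smooth_on_interval_def by blast
  have "continuous_on {a..b} h"
    by (rule continuous_on_subset[OF smooth_on_imp_continuous_on[OF h(3)] h(2)])
  then show ?thesis by (rule continuous_on_eq) (rule h(4))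
qed

lemma smooth_on_interval_velocity:
  assumes "smooth_on_interval 0 1 c" "t \<in> {0..1}"
  shows "(c has_vector_derivative velocity c t) (at t within {0..1})"
proof -
  obtain T h where h: "open T" "{0..1} \<subseteq> T" "smooth_on h T" "\<And>t. t \<in> {0..1} \<Longrightarrow> h t = c t"
    using assms(1) unfolding smooth_on_interval_def by blast
  have "h differentiable (at t)"
    by (rule differentiableI, rule smooth_onD[OF h(3)]) (use h(2) assms(2) in blast)
  then have "h differentiable (at t within {0..1})"
    by (rule differentiable_at_withinI)
  then have "c differentiable (at t within {0..1})"
    using differentiable_transform_within[of h t "{0..1}" 1 c] h(4) assms(2) by simp
  then show ?thesis
    unfolding velocity_def by (simp add: vector_derivative_works)
qed

text \<open>Local extensions may disagree with one another outside the interval. As the outside has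
  just two separate sides, choosing one extension for each side replaces a partition of
  unity.\<close>

lemma smooth_on_intervalI_local:
  fixes c :: "real \<Rightarrow> 'a::euclidean_space"
  assumes "a < b"
    and loc: "\<And>t. t \<in> {a..b} \<Longrightarrow>
      \<exists>U h. open U \<and> t \<in> U \<and> smooth_on h U \<and> (\<forall>s \<in> U \<inter> {a..b}. h s = c s)"
  shows "smooth_on_interval a b c"
proof -
  obtain U h where U: "open U" "a \<in> U" "smooth_on h U" "\<And>s. s \<in> U \<inter> {a..b} \<Longrightarrow> h s = c s"
    using loc[of a] assms(1) by auto
  obtain V k where V: "open V" "b \<in> V" "smooth_on k V" "\<And>s. s \<in> V \<inter> {a..b} \<Longrightarrow> k s = c s"
    using loc[of b] assms(1) by auto
  \<comment> \<open>Only the one-sided extensions at \<open>a\<close> and \<open>b\<close> are used outside the interval; inside it, \<open>c\<close> itself is smooth.\<close>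
  define d where "d = (\<lambda>t. if t < a then h t else if t > b then k t else c t)"
  have "smooth_on d (U \<inter> {..<b} \<union> {a<..<b} \<union> V \<inter> {a<..})" (is "smooth_on d ?T")
  proof (rule smooth_on_local)
    fix t assume "t \<in> ?T"
    then consider "t \<in> U \<inter> {..<b}" | "t \<in> {a<..<b}" | "t \<in> V \<inter> {a<..}" by blast
    then show "\<exists>W g. open W \<and> t \<in> W \<and> smooth_on g W \<and> (\<forall>s\<in>W. d s = g s)"
    proof cases
      case 1
      moreover have "\<forall>s\<in>U \<inter> {..<b}. d s = h s" using U(4) by (auto simp: d_def)
      ultimately show ?thesis
        using U by (intro exI[of _ "U \<inter> {..<b}"] exI[of _ h]) (auto intro: smooth_on_subset)
    next
      case 2
      then obtain W g where W: "open W" "t \<in> W" "smooth_on g W" "\<forall>s \<in> W \<inter> {a..b}. g s = c s"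
        using loc[of t] by auto
      then have "\<forall>s\<in>W \<inter> {a<..<b}. d s = g s" by (auto simp: d_def)
      with 2 W(1-3) show ?thesis
        by (intro exI[of _ "W \<inter> {a<..<b}"] exI[of _ g]) (auto intro: smooth_on_subset)
    next
      case 3
      moreover have "\<forall>s\<in>V \<inter> {a<..}. d s = k s"
        using V(4) by (auto simp: d_def)
      ultimately show ?thesis
        using V by (intro exI[of _ "V \<inter> {a<..}"] exI[of _ k]) (auto intro: smooth_on_subset)
    qed
  qed
  moreover have "{a..b} \<subseteq> ?T" using U(2) V(2) assms(1) by (auto simp: less_le)
  moreover have "open ?T"
    by (intro open_Un open_Int U(1) V(1) open_lessThan open_greaterThanLessThan open_greaterThan)
  moreover have "\<forall>t\<in>{a..b}. d t = c t" by (auto simp: d_def)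
  ultimately show ?thesis
    unfolding smooth_on_interval_def by blast
qed

text \<open>Upgrades a continuous lift \<open>d\<close> of a smooth curve \<open>c\<close> to a
  smooth one: near each time, \<open>d\<close> is \<open>c\<close> followed by a smooth local left
  inverse of \<open>f\<close>.\<close>

lemma smooth_on_interval_lift:
  fixes f :: "'a::euclidean_space \<Rightarrow> 'b::euclidean_space"
  assumes "open S" "smooth_embedding S M f" "smooth_on_interval a b c" "a < b"
    and contd: "continuous_on {a..b} d" and d: "\<And>t. t \<in> {a..b} \<Longrightarrow> d t \<in> S \<and> c t = f (d t)"
  shows "smooth_on_interval a b d"
proof (rule smooth_on_intervalI_local[OF assms(4)])
  fix t assume t: "t \<in> {a..b}"
  have f: "smooth_on f S" "inj (frechet_derivative f (at (d t)))"
    using assms(2) d[OF t] by (auto simp: smooth_embedding_def)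
  obtain T h where h: "open T" "{a..b} \<subseteq> T" "smooth_on h T" "\<And>s. s \<in> {a..b} \<Longrightarrow> h s = c s"
    using assms(3) unfolding smooth_on_interval_def by blast
  obtain U W \<psi> where U: "open U" "U \<subseteq> S" "d t \<in> U" and W: "open W" "f ` U \<subseteq> W" "smooth_on \<psi> W"
    and \<psi>: "\<And>x. x \<in> U \<Longrightarrow> \<psi> (f x) = x"
    using immersion_local_left_inverse[OF assms(1) f(1) conjunct1[OF d[OF t]] f(2)] by metis
  \<comment> \<open>That \<open>c s\<close> lies in \<open>W\<close> does not put \<open>d s\<close>
    into \<open>U\<close>, since \<open>f\<close> may map other points into \<open>W\<close>.
    Continuity of \<open>d\<close> supplies times \<open>N\<close> for which it does.\<close>
  obtain N where N: "open N" "N \<inter> {a..b} = d -` U \<inter> {a..b}"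
    using contd U(1) unfolding continuous_on_open_invariant by blast
  define T' where "T' = T \<inter> h -` W"
  have T': "open T'"
    unfolding T'_def
    by (rule continuous_open_preimage[OF smooth_on_imp_continuous_on[OF h(3)] h(1) W(1)])
  have "smooth_on (\<lambda>s. \<psi> (h s)) (T' \<inter> N)"
    by (rule smooth_on_compose[OF W(1) _ _ W(3) smooth_on_subset[OF h(3)]])
      (use T' N in \<open>auto simp: T'_def\<close>)
  moreover have "t \<in> T' \<inter> N"
    using t h(2,4) U(3) N(2) W(2) d[OF t] by (auto simp: T'_def)
  moreover have "\<psi> (h s) = d s" if "s \<in> (T' \<inter> N) \<inter> {a..b}" for s
  proof -
    have "d s \<in> U" using that N(2) by blast
    then show ?thesis using that h(4) d by (simp add: \<psi>)
  qed
  ultimately show "\<exists>U h. open U \<and> t \<in> U \<and> smooth_on h U \<and> (\<forall>s \<in> U \<inter> {a..b}. h s = d s)"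
    using T' N(1) by (intro exI[of _ "T' \<inter> N"] exI[of _ "\<lambda>s. \<psi> (h s)"]) auto
qed

section \<open>Lengths and the Riemannian distance\<close>

text \<open>By the chain rule the derivative of \<open>f\<close> carries the velocity of
  \<open>d\<close> to that of \<open>c\<close>, so the integrands agree at every time.\<close>

lemma curve_length_isometry:
  assumes "isometric_embedding S gS M gM f" "smooth_on_interval 0 1 d"
    and d: "\<And>t. t \<in> {0..1} \<Longrightarrow> d t \<in> S" "\<And>t. t \<in> {0..1} \<Longrightarrow> c t = f (d t)"
  shows "curve_length gM c = curve_length gS d"
  unfolding curve_length_def
proof (rule integral_cong)
  fix t :: real assume t: "t \<in> {0..1}"
  have f: "(f has_derivative frechet_derivative f (at (d t))) (at (d t))"
    using assms(1) d(1)[OF t]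
    by (auto simp: isometric_embedding_def smooth_embedding_def intro: smooth_onD)
  have "((f \<circ> d) has_vector_derivative frechet_derivative f (at (d t)) (velocity d t)) (at t within {0..1})"
    by (rule vector_derivative_diff_chain_within[OF smooth_on_interval_velocity[OF assms(2) t]
          has_derivative_at_withinI[OF f]])
  then have "(c has_vector_derivative frechet_derivative f (at (d t)) (velocity d t)) (at t within {0..1})"
    by (rule has_vector_derivative_transform[rotated 2]) (use d(2) t in auto)
  \<comment> \<open>Derivatives within \<open>{0..1}\<close> are unique at the endpoints too, where
    they are one-sided.\<close>
  then have "velocity c t = frechet_derivative f (at (d t)) (velocity d t)"
    unfolding velocity_def using t vector_derivative_within_cbox[of 0 1 t c] by simp
  then show "sqrt (gM (c t) (velocity c t) (velocity c t)) = sqrt (gS (d t) (velocity d t) (velocity d t))"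
    using assms(1) d t by (simp add: isometric_embedding_def)
qed

lemma curves_joiningI:
  assumes "smooth_on_interval 0 1 c" "path_image c \<subseteq> \<Theta>" "pathstart c = x" "pathfinish c = y"
  shows "c \<in> curves_joining \<Theta> x y"
proof -
  \<comment> \<open>A single piece, with breakpoints \<open>real 0 = 0\<close> and
    \<open>real 1 = 1\<close>.\<close>
  have "piecewise_smooth_path c"
    unfolding piecewise_smooth_path_def path_def
    using smooth_on_interval_imp_continuous_on[OF assms(1)] assms(1)
    by (auto intro!: exI[of _ "1::nat"] exI[of _ real])
  then show ?thesis using assms by (simp add: curves_joining_def)
qed

text \<open>A real infimum is known to lie below the members of a set once that set is bounded
  below; nonnegativity of the metric makes 0 a lower bound for the lengths.\<close>

lemma riemannian_distance_le_curve_length: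
  assumes nonneg: "\<And>\<theta> u. \<theta> \<in> \<Theta> \<Longrightarrow> 0 \<le> g \<theta> u u" and c: "c \<in> curves_joining \<Theta> x y"
  shows "riemannian_distance \<Theta> g x y \<le> curve_length g c"
  unfolding riemannian_distance_def
proof (rule cINF_lower[OF _ c], rule bdd_belowI2)
  fix c assume "c \<in> curves_joining \<Theta> x y"
  then have "0 \<le> sqrt (g (c t) (velocity c t) (velocity c t))" if "t \<in> {0..1}" for t
    using that nonneg by (auto simp: curves_joining_def path_image_def image_subset_iff)
  then show "0 \<le> curve_length g c"
    unfolding curve_length_def
    \<comment> \<open>The integral of a non-integrable function is 0, so integrability of the speed
      need not be settled.\<close>
    by (metis (lifting) Henstock_Kurzweil_Integration.integral_nonneg not_integrable_integral order_refl)
qed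

lemma (in regular_statistical_model) fisher_metric_nonneg:
  "\<theta> \<in> \<Theta> \<Longrightarrow> 0 \<le> fisher_metric \<mu> p \<theta> u u"
  unfolding fisher_metric_def by (intro Bochner_Integration.integral_nonneg) (simp add: nonneg_density)

section \<open>Comparison of the Fisher-Rao distances\<close>

theorem mainTheorem13:
  fixes \<mu> :: "'x measure" and p :: "'a::euclidean_space \<Rightarrow> 'x \<Rightarrow> real" and S :: "'a set"
    and \<nu> :: "'y measure" and q :: "'b::euclidean_space \<Rightarrow> 'y \<Rightarrow> real" and M :: "'b set"
    and f :: "'a \<Rightarrow> 'b"
  assumes "fisher_rao_manifold \<mu> p S"
    and "fisher_rao_manifold \<nu> q M"
    and "isometric_embedding S (fisher_metric \<mu> p) M (fisher_metric \<nu> q) f"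
  shows "(totally_geodesic M (fisher_metric \<nu> q) (f ` S) \<longrightarrow>
           (\<forall>\<theta>\<^sub>0\<in>S. \<forall>\<theta>\<^sub>1\<in>S.
              fisher_rao_distance \<mu> p S \<theta>\<^sub>0 \<theta>\<^sub>1 = fisher_rao_distance \<nu> q M (f \<theta>\<^sub>0) (f \<theta>\<^sub>1))) \<and>
         (\<not> totally_geodesic M (fisher_metric \<nu> q) (f ` S) \<longrightarrow>
           (\<forall>\<theta>\<^sub>0\<in>S. \<forall>\<theta>\<^sub>1\<in>S.
              fisher_rao_distance \<nu> q M (f \<theta>\<^sub>0) (f \<theta>\<^sub>1) \<le> fisher_rao_distance \<mu> p S \<theta>\<^sub>0 \<theta>\<^sub>1))"
proof -
  interpret S: fisher_rao_manifold \<mu> p S by fact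
  interpret M: fisher_rao_manifold \<nu> q M by fact
  let ?gS = "fisher_metric \<mu> p" and ?gM = "fisher_metric \<nu> q"
  have emb: "smooth_embedding S M f"
    using assms(3) by (simp add: isometric_embedding_def)
  then have smooth: "smooth_on f S" and fM: "f ` S \<subseteq> M"
    by (auto simp: smooth_embedding_def)
  obtain f' where hom: "homeomorphism S (f ` S) f f'"
    using emb by (auto simp: smooth_embedding_def)
  \<comment> \<open>This holds for every isometric embedding; it is the second claim and one half of
    the first.\<close>
  have le: "fisher_rao_distance \<nu> q M (f x) (f y) \<le> fisher_rao_distance \<mu> p S x y"
    if xy: "x \<in> S" "y \<in> S" for x y
  proof -
    \<comment> \<open>The infimum in \<open>S\<close> is attained by a smooth curve, so transporting
      this one curve suffices.\<close>
    obtain d where "minimizing_geodesic S ?gS x y d"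
      using S.minimizing_geodesic_exists[OF xy] by blast
    then have d: "smooth_on_interval 0 1 d" "path_image d \<subseteq> S" "pathstart d = x" "pathfinish d = y"
      and len: "curve_length ?gS d = riemannian_distance S ?gS x y"
      by (auto simp: minimizing_geodesic_def geodesic_def)
    have dS: "d t \<in> S" if "t \<in> {0..1}" for t
      using that d(2) by (auto simp: path_image_def)
    have "f \<circ> d \<in> curves_joining M (f x) (f y)"
    proof (rule curves_joiningI)
      show "smooth_on_interval 0 1 (f \<circ> d)"
        by (rule smooth_on_interval_compose[OF d(1) dS S.open_domain smooth]) auto
      show "path_image (f \<circ> d) \<subseteq> M"
        using dS fM by (auto simp: path_image_def)
    qed (use d(3,4) in \<open>auto simp: pathstart_def pathfinish_def\<close>)
    from riemannian_distance_le_curve_length[OF M.fisher_metric_nonneg this]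
    have "riemannian_distance M ?gM (f x) (f y) \<le> curve_length ?gM (f \<circ> d)" .
    also have "\<dots> = curve_length ?gS d"
      by (rule curve_length_isometry[OF assms(3) d(1) dS]) auto
    finally show ?thesis by (simp add: fisher_rao_distance_def len)
  qed
  have ge: "fisher_rao_distance \<mu> p S x y \<le> fisher_rao_distance \<nu> q M (f x) (f y)"
    if tg: "totally_geodesic M ?gM (f ` S)" and xy: "x \<in> S" "y \<in> S" for x y
  proof -
    obtain c where "minimizing_geodesic M ?gM (f x) (f y) c"
      using M.minimizing_geodesic_exists xy fM by blast
    then have geo: "geodesic M ?gM c" "pathstart c = f x" "pathfinish c = f y"
      and len: "curve_length ?gM c = riemannian_distance M ?gM (f x) (f y)"
      by (auto simp: minimizing_geodesic_def)
    have c: "smooth_on_interval 0 1 c" using geo(1) by (simp add: geodesic_def)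
    have "path_image c \<subseteq> f ` S"
      using tg geo xy unfolding totally_geodesic_def by blast
    then have cN: "c t \<in> f ` S" if "t \<in> {0..1}" for t
      using that by (auto simp: path_image_def)
    \<comment> \<open>The inverse \<open>f'\<close> is only known to be continuous on the image of
      \<open>f\<close>; \<open>smooth_on_interval_lift\<close> then makes \<open>d\<close>
      smooth.\<close>
    define d where "d = f' \<circ> c"
    have dS: "d t \<in> S" and cd: "c t = f (d t)" if "t \<in> {0..1}" for t
      using cN[OF that] hom by (auto simp: homeomorphism_def d_def)
    have "continuous_on {0..1} d"
      unfolding d_def using hom cN
      by (intro continuous_on_compose smooth_on_interval_imp_continuous_on[OF c])
        (auto simp: homeomorphism_def intro: continuous_on_subset)
    then have sd: "smooth_on_interval 0 1 d"
      using smooth_on_interval_lift[OF S.open_domain emb c] dS cd by simp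
    have "d \<in> curves_joining S x y"
    proof (rule curves_joiningI[OF sd])
      show "path_image d \<subseteq> S" using dS by (auto simp: path_image_def)
      show "pathstart d = x" "pathfinish d = y"
        using geo(2,3) hom xy by (auto simp: pathstart_def pathfinish_def d_def homeomorphism_def)
    qed
    from riemannian_distance_le_curve_length[OF S.fisher_metric_nonneg this]
    have "riemannian_distance S ?gS x y \<le> curve_length ?gS d" .
    also have "\<dots> = curve_length ?gM c"
      by (rule curve_length_isometry[OF assms(3) sd dS cd, symmetric])
    finally show ?thesis by (simp add: fisher_rao_distance_def len)
  qed
  show ?thesis using le ge by (meson order_antisym)
qed

end
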